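(* Let $K\ge1$ and $C>0$ be constants. Suppose that, for each $n$, there is a quantum algorithm that makes at most $t=t(n)$ quantum queries to $O_A$ and, for every nonempty $A\subseteq\mathbb{F}_2^n$ with $|A+A|\le K|A|$, outputs with non-negligible probability a linear subspace $H\le\mathbb{F}_2^n$ with $|H|\le|A|$ such that $A$ is covered by at most $(2K)^C$ cosets of $H$. Then $t=\Omega_K(n)$.
   Context: $A+A=\{a+a':a,a'\in A\}$. The quantum oracle is the unitary $O_A:|x,b\rangle\mapsto|x,b\oplus\mathbf{1}_A(x)\rangle$ for $x\in\mathbb{F}_2^n$, $b\in\{0,1\}$, and it is the algorithm's only access to $A$ (there is no random-sample access). "Non-negligible probability" means probability at least $n^{-a}$ for some constant $a>0$ and all sufficiently large $n$. $t=\Omega_K(n)$ means there is a constant $c>0$, which may depend on $K$, with $t(n)\ge cn$ for all sufficiently large $n$ (depending on $K$, $C$, $a$). *)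

theory Defs
  imports
    Complex_Main
    "HOL-Library.Z2"
    "HOL-Library.Set_Algebras"
    "Jordan_Normal_Form.VS_Connect"
begin

section \<open>Linear structure of the cube\<close>

text \<open>The space \<open>F\<^sub>2\<^sup>n\<close> is the carrier of \<^term>\<open>module_vec TYPE(bit) n\<close>.  The sumset
  \<^term>\<open>A + A\<close> and the coset \<^term>\<open>x +o H\<close> are those of Set Algebras.\<close>

abbreviation cube :: "nat \<Rightarrow> bit vec set" where
  "cube n \<equiv> carrier_vec n"

definition linear_subspace :: "nat \<Rightarrow> bit vec set \<Rightarrow> bool" where
  "linear_subspace n H \<longleftrightarrow> VectorSpace.subspace class_ring H (module_vec TYPE(bit) n)"

definition cosets :: "nat \<Rightarrow> bit vec set \<Rightarrow> bit vec set set" where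
  "cosets n H = (\<lambda>x. x +o H) ` cube n"

text \<open>The bound \<open>r\<close> on the number of cosets is real because \<open>(2K)\<^sup>C\<close> is.\<close>

definition covered_by_cosets :: "nat \<Rightarrow> bit vec set \<Rightarrow> real \<Rightarrow> bit vec set \<Rightarrow> bool" where
  "covered_by_cosets n H r A \<longleftrightarrow>
     (\<exists>S. S \<subseteq> cosets n H \<and> finite S \<and> real (card S) \<le> r \<and> A \<subseteq> \<Union>S)"


section \<open>Quantum query algorithms\<close>

text \<open>A computational basis state \<open>|x, b, w\<rangle>\<close> consists of the two query registers
  and a work register of finite dimension \<open>m\<close>, with \<open>w < m\<close>.  State vectors are functions on
  basis states and operators are matrices indexed by basis states; only entries with indices
  in \<open>qbasis n m\<close> are ever used.\<close>

type_synonym qindex = "bit vec \<times> bit \<times> nat"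
type_synonym qstate = "qindex \<Rightarrow> complex"
type_synonym qmatrix = "qindex \<Rightarrow> qindex \<Rightarrow> complex"

definition qbasis :: "nat \<Rightarrow> nat \<Rightarrow> qindex set" where
  "qbasis n m = cube n \<times> UNIV \<times> {..<m}"

definition ket :: "qindex \<Rightarrow> qstate" where
  "ket z = (\<lambda>y. if y = z then 1 else 0)"

definition apply_matrix :: "qindex set \<Rightarrow> qmatrix \<Rightarrow> qstate \<Rightarrow> qstate" where
  "apply_matrix B U \<psi> = (\<lambda>y. \<Sum>z\<in>B. U y z * \<psi> z)"

definition unitary_on :: "qindex set \<Rightarrow> qmatrix \<Rightarrow> bool" where
  "unitary_on B U \<longleftrightarrow>
     (\<forall>x\<in>B. \<forall>y\<in>B. (\<Sum>z\<in>B. cnj (U z x) * U z y) = (if x = y then 1 else 0)) \<and>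
     (\<forall>x\<in>B. \<forall>y\<in>B. (\<Sum>z\<in>B. U x z * cnj (U y z)) = (if x = y then 1 else 0))"

text \<open>The unitary \<open>O\<^sub>A\<close>, extended by the identity on the work register.  Addition of type
  \<^typ>\<open>bit\<close> is exclusive or.\<close>

definition query_matrix :: "bit vec set \<Rightarrow> qmatrix" where
  "query_matrix A = (\<lambda>y (x, b, w). ket (x, b + (if x \<in> A then 1 else 0), w) y)"

text \<open>The algorithm applies \<open>U 0\<close>, then alternates queries with \<open>U 1, ..., U q\<close>, where
  \<open>q\<close> is its number of queries.  It finally measures all registers in the computational basis
  and returns a set computed from the outcome.  As the work register is
  arbitrary, this subsumes intermediate measurements, internal randomness and general final
  measurements.  The returned set need not be a subspace; such an output is a failure.\<close>

record query_algorithm =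
  work_dim :: nat
  num_queries :: nat
  gate :: "nat \<Rightarrow> qmatrix"
  result :: "qindex \<Rightarrow> bit vec set"

definition is_query_algorithm :: "nat \<Rightarrow> query_algorithm \<Rightarrow> bool" where
  "is_query_algorithm n Q \<longleftrightarrow>
     work_dim Q > 0 \<and> (\<forall>j\<le>num_queries Q. unitary_on (qbasis n (work_dim Q)) (gate Q j))"

primrec state_after :: "nat \<Rightarrow> query_algorithm \<Rightarrow> bit vec set \<Rightarrow> nat \<Rightarrow> qstate" where
  "state_after n Q A 0 =
     apply_matrix (qbasis n (work_dim Q)) (gate Q 0) (ket (0\<^sub>v n, 0, 0))"
| "state_after n Q A (Suc j) =
     apply_matrix (qbasis n (work_dim Q)) (gate Q (Suc j))
       (apply_matrix (qbasis n (work_dim Q)) (query_matrix A) (state_after n Q A j))"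

definition output_prob ::
  "nat \<Rightarrow> query_algorithm \<Rightarrow> bit vec set \<Rightarrow> (bit vec set \<Rightarrow> bool) \<Rightarrow> real" where
  "output_prob n Q A P =
     (\<Sum>z\<in>{z \<in> qbasis n (work_dim Q). P (result Q z)}.
        (cmod (state_after n Q A (num_queries Q) z))\<^sup>2)"

lemma finite_cube: "finite (cube n)"
proof -
  have fin: "finite (UNIV :: bit set)"
  proof (rule finite_subset)
    show "(UNIV :: bit set) \<subseteq> {0, 1}" by (auto intro: bit.exhaust)
  qed simp
  have "finite {xs :: bit list. set xs \<subseteq> UNIV \<and> length xs = n}"
    by (rule finite_lists_length_eq[OF fin])
  moreover have "cube n \<subseteq> vec_of_list ` {xs :: bit list. set xs \<subseteq> UNIV \<and> length xs = n}"
  proof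
    fix v :: "bit vec" assume "v \<in> cube n"
    then have "v = vec_of_list (list_of_vec v)" "length (list_of_vec v) = n"
      by (auto simp: vec_list)
    then show "v \<in> vec_of_list ` {xs :: bit list. set xs \<subseteq> UNIV \<and> length xs = n}"
      by blast
  qed
  ultimately show ?thesis by (blast intro: finite_subset)
qed

lemma finite_qbasis: "finite (qbasis n m)"
proof -
  have "(UNIV :: bit set) = {0, 1}" by (auto intro: bit.exhaust)
  then have "finite (UNIV :: bit set)" by (metis finite.emptyI finite_insert)
  then show ?thesis by (simp add: qbasis_def finite_cube)
qed

lemma query_matrix_ket:
  assumes "(x, b, w) \<in> qbasis n m"
  shows "apply_matrix (qbasis n m) (query_matrix A) (ket (x, b, w)) =
    ket (x, b + (if x \<in> A then 1 else 0), w)"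
proof
  fix y
  have "apply_matrix (qbasis n m) (query_matrix A) (ket (x, b, w)) y =
      (\<Sum>z\<in>qbasis n m. if z = (x, b, w) then query_matrix A y z else 0)"
    unfolding apply_matrix_def by (rule sum.cong) (auto simp: ket_def)
  also have "\<dots> = query_matrix A y (x, b, w)"
    using assms by (simp add: finite_qbasis)
  finally show "apply_matrix (qbasis n m) (query_matrix A) (ket (x, b, w)) y =
      ket (x, b + (if x \<in> A then 1 else 0), w) y"
    by (simp add: query_matrix_def)
qed

lemma unitary_query_matrix: "unitary_on (qbasis n m) (query_matrix A)"
proof -
  define B where "B = qbasis n m"
  define f :: "qindex \<Rightarrow> qindex"
    where "f = (\<lambda>(x, b, w). (x, b + (if x \<in> A then 1 else 0), w))"
  have fin: "finite B" unfolding B_def by (rule finite_qbasis)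
  have inv: "f (f z) = z" for z
    by (cases z) (simp add: f_def add.assoc)
  have fB: "f z \<in> B" if "z \<in> B" for z
    using that by (cases z) (simp add: f_def B_def qbasis_def)
  have o: "query_matrix A y z = (if y = f z then 1 else 0)" for y z
    by (cases z) (simp add: query_matrix_def ket_def f_def)
  have o': "query_matrix A y z = (if z = f y then 1 else 0)" for y z
    unfolding o using inv by metis
  have inj: "f x = f y \<longleftrightarrow> x = y" for x y
    using inv by metis
  have "(\<Sum>z\<in>B. cnj (query_matrix A z x) * query_matrix A z y) = (if x = y then 1 else 0)"
    if "x \<in> B" for x y
  proof -
    have "(\<Sum>z\<in>B. cnj (query_matrix A z x) * query_matrix A z y) =
        (\<Sum>z\<in>B. if z = f x then (if x = y then 1 else 0) else 0)"
      by (rule sum.cong) (auto simp: o inj)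
    then show ?thesis using fin fB[OF that] by simp
  qed
  moreover have "(\<Sum>z\<in>B. query_matrix A x z * cnj (query_matrix A y z)) = (if x = y then 1 else 0)"
    if "x \<in> B" for x y
  proof -
    have "(\<Sum>z\<in>B. query_matrix A x z * cnj (query_matrix A y z)) =
        (\<Sum>z\<in>B. if z = f x then (if x = y then 1 else 0) else 0)"
      by (rule sum.cong) (auto simp: o' inj)
    then show ?thesis using fin fB[OF that] by simp
  qed
  ultimately show ?thesis unfolding unitary_on_def B_def by blast
qed

end

theory Submission
  imports Defs "HOL-Analysis.L2_Norm" "HOL-Analysis.Convex" "HOL-Real_Asymp.Real_Asymp"
begin

text \<open>Every subspace \<open>A\<close> satisfies \<open>|A + A| = |A|\<close>, so an algorithm as in the theorem must in
  particular handle subspaces of a constant dimension \<open>d\<close>, chosen so large that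
  \<open>2\<^sup>d > (2K)\<^sup>C\<close>.  By the pigeonhole principle a subspace \<open>H\<close> with at most \<open>(2K)\<^sup>C\<close> cosets
  covering \<open>A\<close> then contains a nonzero element of \<open>A\<close> (\<open>cover_meets_nontrivially\<close>).  So the
  algorithm has to find an exponentially sparse hidden set, and this is as hard as unstructured
  search: it takes exponentially many queries, for every \<open>K\<close>.  This is why \<open>c = 1\<close> works
  whatever the values of \<open>K\<close>, \<open>C\<close> and \<open>a\<close>.

  The hidden sets come from an explicit family.  Cut the coordinates into \<open>n div d\<close> blocks of
  length \<open>d\<close>.  For a nonempty set \<open>S\<close> of blocks let \<open>A\<^sub>S\<close> consist of the vectors that carry the
  same word \<open>u\<close> in each block of \<open>S\<close> and vanish elsewhere.  A nonzero vector of this kind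
  reveals \<open>S\<close> as the set of blocks where it does not vanish (\<open>tiles_determine_blocks\<close>), so
  these \<open>2\<^bsup>n div d\<^esup> - 1\<close> subspaces pairwise meet in \<open>0\<close>.

  The lower bound is the hybrid argument of Bennett, Bernstein, Brassard and Vazirani, with the
  oracle of \<open>{0}\<close> as the reference.  Replacing this oracle by that of \<open>A\<^sub>S\<close> moves the final state
  by at most twice the sum, over the \<open>T\<close> queries, of the amplitude that the reference run puts on
  \<open>A\<^sub>S - {0}\<close> (\<open>hybrid\<close>).  As these sets are disjoint, the squared distances sum to at most
  \<open>4T\<^sup>2\<close> over all \<open>S\<close>.  The output distribution of the reference run does not depend on \<open>S\<close>, and
  one output \<open>H\<close> with \<open>|H| \<le> 2\<^sup>d\<close> is right for at most \<open>2\<^sup>d\<close> of the sets \<open>S\<close>, because it must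
  contain a nonzero element of each such \<open>A\<^sub>S\<close>.  So the success probabilities sum to at most
  \<open>2 * 2\<^sup>d + 8T\<^sup>2\<close> (\<open>sum_output_prob_le\<close>).  They also sum to at least \<open>(2\<^bsup>n div d\<^esup> - 1) n\<^bsup>-a\<^esup>\<close>,
  which is larger for large \<open>n\<close> unless \<open>T\<close> exceeds \<open>n\<close>.\<close>

section \<open>The norm of a state\<close>

definition qnorm :: "qindex set \<Rightarrow> qstate \<Rightarrow> real" where
  "qnorm B \<psi> = L2_set (\<lambda>z. cmod (\<psi> z)) B"

lemma qnorm_nonneg: "0 \<le> qnorm B \<psi>"
  by (simp add: qnorm_def L2_set_nonneg)

lemma qnorm_sq: "(qnorm B \<psi>)\<^sup>2 = (\<Sum>z\<in>B. (cmod (\<psi> z))\<^sup>2)"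
  by (simp add: qnorm_def L2_set_def sum_nonneg)

lemma qnorm_add_le: "qnorm B (\<lambda>z. \<psi> z + \<phi> z) \<le> qnorm B \<psi> + qnorm B \<phi>"
proof -
  have "qnorm B (\<lambda>z. \<psi> z + \<phi> z) \<le> L2_set (\<lambda>z. cmod (\<psi> z) + cmod (\<phi> z)) B"
    unfolding qnorm_def by (rule L2_set_mono) (simp_all add: norm_triangle_ineq)
  also have "\<dots> \<le> qnorm B \<psi> + qnorm B \<phi>"
    unfolding qnorm_def by (rule L2_set_triangle_ineq)
  finally show ?thesis .
qed

lemma qnorm_minus: "qnorm B (\<lambda>z. - \<psi> z) = qnorm B \<psi>"
  by (simp add: qnorm_def)

lemma qnorm_diff_le: "qnorm B (\<lambda>z. \<psi> z - \<phi> z) \<le> qnorm B \<psi> + qnorm B \<phi>"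
  using qnorm_add_le[of B \<psi> "\<lambda>z. - \<phi> z"] by (simp add: qnorm_minus)

lemma apply_matrix_diff:
  "apply_matrix B U (\<lambda>z. \<psi> z - \<phi> z) = (\<lambda>y. apply_matrix B U \<psi> y - apply_matrix B U \<phi> y)"
  by (simp add: apply_matrix_def right_diff_distrib sum_subtractf)

lemma qnorm_unitary:
  assumes "unitary_on B U" "finite B"
  shows "qnorm B (apply_matrix B U \<psi>) = qnorm B \<psi>"
proof -
  have "complex_of_real (\<Sum>y\<in>B. (cmod (apply_matrix B U \<psi> y))\<^sup>2)
      = (\<Sum>y\<in>B. (\<Sum>z\<in>B. U y z * \<psi> z) * (\<Sum>x\<in>B. cnj (U y x) * cnj (\<psi> x)))"
    by (simp add: complex_norm_square apply_matrix_def del: of_real_power)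
  also have "\<dots> = (\<Sum>y\<in>B. \<Sum>z\<in>B. \<Sum>x\<in>B. \<psi> z * cnj (\<psi> x) * (cnj (U y x) * U y z))"
    by (simp add: sum_product mult_ac)
  also have "\<dots> = (\<Sum>z\<in>B. \<Sum>y\<in>B. \<Sum>x\<in>B. \<psi> z * cnj (\<psi> x) * (cnj (U y x) * U y z))"
    by (rule sum.swap)
  also have "\<dots> = (\<Sum>z\<in>B. \<Sum>x\<in>B. \<Sum>y\<in>B. \<psi> z * cnj (\<psi> x) * (cnj (U y x) * U y z))"
    by (rule sum.cong[OF refl], rule sum.swap)
  also have "\<dots> = (\<Sum>z\<in>B. \<Sum>x\<in>B. \<psi> z * cnj (\<psi> x) * (\<Sum>y\<in>B. cnj (U y x) * U y z))"
    by (simp add: sum_distrib_left)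
  also have "\<dots> = (\<Sum>z\<in>B. \<Sum>x\<in>B. if x = z then \<psi> z * cnj (\<psi> x) else 0)"
    using assms(1) by (intro sum.cong refl) (simp add: unitary_on_def)
  also have "\<dots> = complex_of_real (\<Sum>z\<in>B. (cmod (\<psi> z))\<^sup>2)"
    using assms(2) by (simp add: complex_norm_square del: of_real_power)
  finally have "(qnorm B (apply_matrix B U \<psi>))\<^sup>2 = (qnorm B \<psi>)\<^sup>2"
    unfolding qnorm_sq using of_real_eq_iff by blast
  then show ?thesis
    by (simp add: qnorm_nonneg power2_eq_iff_nonneg)
qed

lemma qnorm_state_after:
  assumes "is_query_algorithm n Q" "j \<le> num_queries Q"
  shows "qnorm (qbasis n (work_dim Q)) (state_after n Q A j) = 1"
  using assms(2)
proof (induction j)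
  case 0
  define z0 :: qindex where "z0 = (0\<^sub>v n, 0, 0)"
  have "z0 \<in> qbasis n (work_dim Q)"
    using assms(1) by (simp add: is_query_algorithm_def qbasis_def z0_def)
  moreover have "(\<Sum>z\<in>B. (cmod (ket z0 z))\<^sup>2) = (\<Sum>z\<in>B. if z = z0 then 1 else 0)" for B
    by (rule sum.cong) (auto simp: ket_def)
  ultimately have "qnorm (qbasis n (work_dim Q)) (ket z0) = 1"
    by (simp add: qnorm_def L2_set_def finite_qbasis)
  then show ?case
    using assms(1) by (simp add: qnorm_unitary finite_qbasis is_query_algorithm_def z0_def)
next
  case (Suc j)
  then show ?case
    using assms(1)
    by (simp add: qnorm_unitary finite_qbasis unitary_query_matrix is_query_algorithm_def)
qed

section \<open>The hybrid argument\<close>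

definition query_part :: "bit vec set \<Rightarrow> qstate \<Rightarrow> qstate" where
  "query_part X \<psi> = (\<lambda>z. if fst z \<in> X then \<psi> z else 0)"

text \<open>The two oracles act alike on the component that asks outside \<^term>\<open>sym_diff A A'\<close>, so only
  the other component contributes, once through each of the two unitaries.\<close>

lemma query_diff_le:
  fixes n m A A'
  defines "B \<equiv> qbasis n m"
  shows "qnorm B (\<lambda>y. apply_matrix B (query_matrix A) \<psi> y - apply_matrix B (query_matrix A') \<psi> y)
    \<le> 2 * qnorm B (query_part (sym_diff A A') \<psi>)"
proof -
  let ?P = "query_part (sym_diff A A') \<psi>"
  have "apply_matrix B (query_matrix A) \<psi> y - apply_matrix B (query_matrix A') \<psi> y
      = apply_matrix B (query_matrix A) ?P y - apply_matrix B (query_matrix A') ?P y" for y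
    unfolding apply_matrix_def sum_subtractf[symmetric]
    by (rule sum.cong) (auto simp: query_part_def query_matrix_def)
  then have "qnorm B (\<lambda>y. apply_matrix B (query_matrix A) \<psi> y - apply_matrix B (query_matrix A') \<psi> y)
      \<le> qnorm B (apply_matrix B (query_matrix A) ?P) + qnorm B (apply_matrix B (query_matrix A') ?P)"
    using qnorm_diff_le by presburger
  then show ?thesis
    by (simp add: B_def qnorm_unitary unitary_query_matrix finite_qbasis)
qed

text \<open>By unitarity an earlier discrepancy is carried along without growing, so each query only adds
  the effect of swapping the oracle on the current reference state.  The bound involves the run with
  \<open>A'\<close> only, so that one state can be compared with many sets \<open>A\<close> at once.\<close>

lemma hybrid:
  fixes n Q
  defines "B \<equiv> qbasis n (work_dim Q)"
  assumes "is_query_algorithm n Q" "j \<le> num_queries Q"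
  shows "qnorm B (\<lambda>z. state_after n Q A j z - state_after n Q A' j z)
    \<le> 2 * (\<Sum>i<j. qnorm B (query_part (sym_diff A A') (state_after n Q A' i)))"
  using assms(3)
proof (induction j)
  case 0
  then show ?case by (simp add: qnorm_def L2_set_def)
next
  case (Suc j)
  let ?\<phi> = "state_after n Q A j" and ?\<psi> = "state_after n Q A' j"
  let ?O = "\<lambda>A. apply_matrix B (query_matrix A)"
  have U: "unitary_on B (gate Q (Suc j))"
    using assms(2) Suc.prems by (simp add: is_query_algorithm_def B_def)
  have fin: "finite B" by (simp add: B_def finite_qbasis)
  have "qnorm B (\<lambda>z. state_after n Q A (Suc j) z - state_after n Q A' (Suc j) z)
      = qnorm B (\<lambda>y. ?O A ?\<phi> y - ?O A' ?\<psi> y)"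
    using qnorm_unitary[OF U fin, of "\<lambda>y. ?O A ?\<phi> y - ?O A' ?\<psi> y"]
    unfolding apply_matrix_diff by (simp add: B_def)
  also have "\<dots> = qnorm B (\<lambda>y. ?O A (\<lambda>z. ?\<phi> z - ?\<psi> z) y + (?O A ?\<psi> y - ?O A' ?\<psi> y))"
    by (simp add: apply_matrix_diff)
  also have "\<dots> \<le> qnorm B (?O A (\<lambda>z. ?\<phi> z - ?\<psi> z)) + qnorm B (\<lambda>y. ?O A ?\<psi> y - ?O A' ?\<psi> y)"
    by (rule qnorm_add_le)
  also have "\<dots> \<le> qnorm B (\<lambda>z. ?\<phi> z - ?\<psi> z) + 2 * qnorm B (query_part (sym_diff A A') ?\<psi>)"
    unfolding B_def
    by (intro add_mono query_diff_le) (simp add: qnorm_unitary unitary_query_matrix finite_qbasis)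
  also have "\<dots> \<le> 2 * (\<Sum>i<Suc j. qnorm B (query_part (sym_diff A A') (state_after n Q A' i)))"
    using Suc by simp
  finally show ?case .
qed

text \<open>A basis state asks about one point, which lies in at most one of the sets.\<close>

lemma sum_query_part_le:
  fixes \<psi> :: qstate
  assumes "finite B" "finite I" "disjoint_family_on X I"
  shows "(\<Sum>i\<in>I. (qnorm B (query_part (X i) \<psi>))\<^sup>2) \<le> (qnorm B \<psi>)\<^sup>2"
proof -
  have "(\<Sum>i\<in>I. (qnorm B (query_part (X i) \<psi>))\<^sup>2)
      = (\<Sum>i\<in>I. \<Sum>z\<in>B. if fst z \<in> X i then (cmod (\<psi> z))\<^sup>2 else 0)"
    unfolding qnorm_sq by (intro sum.cong refl) (simp add: query_part_def)
  also have "\<dots> = (\<Sum>z\<in>B. \<Sum>i\<in>I. if fst z \<in> X i then (cmod (\<psi> z))\<^sup>2 else 0)"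
    by (rule sum.swap)
  also have "\<dots> = (\<Sum>z\<in>B. card {i\<in>I. fst z \<in> X i} * (cmod (\<psi> z))\<^sup>2)"
    using assms(2) by (simp add: sum.If_cases Int_def)
  also have "\<dots> \<le> (\<Sum>z\<in>B. (cmod (\<psi> z))\<^sup>2)"
  proof (rule sum_mono)
    fix z :: qindex
    have "card {i\<in>I. fst z \<in> X i} \<le> 1"
      using assms(2,3) by (auto simp: card_le_Suc0_iff_eq disjoint_family_on_def)
    then show "card {i\<in>I. fst z \<in> X i} * (cmod (\<psi> z))\<^sup>2 \<le> (cmod (\<psi> z))\<^sup>2"
      by (intro mult_left_le_one_le) auto
  qed
  finally show ?thesis by (simp add: qnorm_sq)
qed

text \<open>Search bound for tasks \<open>i \<in> I\<close> with hidden sets \<open>V i\<close> and success criteria \<open>P i\<close>.  The run with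
  the reference set \<open>A'\<close> knows nothing about \<open>i\<close>, so over all tasks its success probabilities sum to
  at most \<open>m\<close>.  Passing to the true final states costs a factor \<open>2\<close> and twice their squared distances
  from the reference state, by \<open>|x|\<^sup>2 \<le> 2|y|\<^sup>2 + 2|x - y|\<^sup>2\<close>.  The distances are quadratic in the number of
  queries: one factor comes from the Cauchy-Schwarz inequality over the queries, the other from the
  unit of squared amplitude which the reference run has for all tasks together at each query.\<close>

lemma sum_output_prob_le:
  assumes alg: "is_query_algorithm n Q" and I: "finite I"
    and disj: "disjoint_family_on (\<lambda>i. sym_diff (V i) A') I"
    and few: "\<And>H. card {i\<in>I. P i H} \<le> m"
  shows "(\<Sum>i\<in>I. output_prob n Q (V i) (P i)) \<le> 2 * real m + 8 * (real (num_queries Q))\<^sup>2"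
proof -
  define B where "B = qbasis n (work_dim Q)"
  define T where "T = num_queries Q"
  define \<psi> where "\<psi> = state_after n Q A'"
  define \<phi> where "\<phi> = (\<lambda>i. state_after n Q (V i) T)"
  define w where "w = (\<lambda>i j. qnorm B (query_part (sym_diff (V i) A') (\<psi> j)))"
  have fin: "finite B" by (simp add: B_def finite_qbasis)
  have unit: "(\<Sum>z\<in>B. (cmod (\<psi> j z))\<^sup>2) = 1" if "j \<le> T" for j
    using qnorm_state_after[OF alg, of j A'] that
    by (simp add: T_def B_def \<psi>_def flip: qnorm_sq)
  have dist: "(qnorm B (\<lambda>z. \<phi> i z - \<psi> T z))\<^sup>2 \<le> 4 * real T * (\<Sum>j<T. (w i j)\<^sup>2)" for i
  proof -
    have "(qnorm B (\<lambda>z. \<phi> i z - \<psi> T z))\<^sup>2 \<le> (2 * (\<Sum>j<T. w i j))\<^sup>2"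
      using hybrid[OF alg, of T "V i" A']
      by (intro power_mono) (simp_all add: qnorm_nonneg T_def B_def \<psi>_def \<phi>_def w_def)
    also have "\<dots> = 4 * (\<Sum>j<T. w i j)\<^sup>2"
      by (simp add: power_mult_distrib)
    also have "\<dots> \<le> 4 * ((\<Sum>j<T. (w i j)\<^sup>2) * card {..<T})"
      by (intro mult_left_mono sum_squared_le_sum_of_squares) simp
    finally show ?thesis by (simp add: mult_ac)
  qed
  have "(\<Sum>i\<in>I. (qnorm B (\<lambda>z. \<phi> i z - \<psi> T z))\<^sup>2) \<le> (\<Sum>i\<in>I. 4 * real T * (\<Sum>j<T. (w i j)\<^sup>2))"
    by (intro sum_mono dist)
  also have "\<dots> = 4 * real T * (\<Sum>j<T. \<Sum>i\<in>I. (w i j)\<^sup>2)"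
    unfolding sum_distrib_left[symmetric] by (subst sum.swap) simp
  also have "\<dots> \<le> 4 * real T * (\<Sum>j<T. 1)"
  proof (intro mult_left_mono sum_mono)
    fix j assume "j \<in> {..<T}"
    then show "(\<Sum>i\<in>I. (w i j)\<^sup>2) \<le> 1"
      using sum_query_part_le[OF fin I disj, of "\<psi> j"] unit[of j]
      by (simp add: w_def qnorm_sq[of B "\<psi> j"])
  qed simp
  finally have far: "(\<Sum>i\<in>I. (qnorm B (\<lambda>z. \<phi> i z - \<psi> T z))\<^sup>2) \<le> 4 * (real T)\<^sup>2"
    by (simp add: power2_eq_square)
  have near: "(\<Sum>i\<in>I. \<Sum>z\<in>{z\<in>B. P i (result Q z)}. (cmod (\<psi> T z))\<^sup>2) \<le> real m"
  proof -
    have "(\<Sum>i\<in>I. \<Sum>z\<in>{z\<in>B. P i (result Q z)}. (cmod (\<psi> T z))\<^sup>2)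
        = (\<Sum>z\<in>B. \<Sum>i\<in>{i\<in>I. P i (result Q z)}. (cmod (\<psi> T z))\<^sup>2)"
      by (rule sum.swap_restrict) (simp_all add: I fin)
    also have "\<dots> \<le> (\<Sum>z\<in>B. m * (cmod (\<psi> T z))\<^sup>2)"
      by (simp add: sum_mono mult_right_mono few)
    finally show ?thesis by (simp add: unit flip: sum_distrib_left)
  qed
  have "output_prob n Q (V i) (P i) \<le> 2 * (\<Sum>z\<in>{z\<in>B. P i (result Q z)}. (cmod (\<psi> T z))\<^sup>2)
      + 2 * (qnorm B (\<lambda>z. \<phi> i z - \<psi> T z))\<^sup>2" for i
  proof -
    have sq: "(cmod x)\<^sup>2 \<le> 2 * (cmod y)\<^sup>2 + 2 * (cmod (x - y))\<^sup>2" for x y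
    proof -
      have "(cmod x)\<^sup>2 \<le> (cmod y + cmod (x - y))\<^sup>2"
        using norm_triangle_sub[of x y] by (intro power_mono) auto
      also have "\<dots> \<le> 2 * (cmod y)\<^sup>2 + 2 * (cmod (x - y))\<^sup>2"
        using sum_squares_bound[of "cmod y" "cmod (x - y)"] by (simp add: power2_sum)
      finally show ?thesis .
    qed
    have "output_prob n Q (V i) (P i) \<le> (\<Sum>z\<in>{z\<in>B. P i (result Q z)}.
        2 * (cmod (\<psi> T z))\<^sup>2 + 2 * (cmod (\<phi> i z - \<psi> T z))\<^sup>2)"
      unfolding output_prob_def B_def[symmetric] T_def[symmetric] \<phi>_def[symmetric]
      using sq by (intro sum_mono) (auto simp: \<phi>_def)
    also have "\<dots> = 2 * (\<Sum>z\<in>{z\<in>B. P i (result Q z)}. (cmod (\<psi> T z))\<^sup>2)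
        + 2 * (\<Sum>z\<in>{z\<in>B. P i (result Q z)}. (cmod (\<phi> i z - \<psi> T z))\<^sup>2)"
      by (simp add: sum.distrib sum_distrib_left)
    also have "(\<Sum>z\<in>{z\<in>B. P i (result Q z)}. (cmod (\<phi> i z - \<psi> T z))\<^sup>2)
        \<le> (qnorm B (\<lambda>z. \<phi> i z - \<psi> T z))\<^sup>2"
      unfolding qnorm_sq using fin by (intro sum_mono2) auto
    finally show ?thesis by simp
  qed
  then have "(\<Sum>i\<in>I. output_prob n Q (V i) (P i))
      \<le> (\<Sum>i\<in>I. 2 * (\<Sum>z\<in>{z\<in>B. P i (result Q z)}. (cmod (\<psi> T z))\<^sup>2)
          + 2 * (qnorm B (\<lambda>z. \<phi> i z - \<psi> T z))\<^sup>2)"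
    by (rule sum_mono)
  then show ?thesis
    using near far by (simp add: sum.distrib T_def flip: sum_distrib_left)
qed

section \<open>Many subspaces that pairwise meet in zero\<close>

text \<open>The word \<open>u\<close> of length \<open>d\<close> is copied into each block \<open>j \<in> S\<close>, where block \<open>j\<close> occupies the
  coordinates from \<open>d * j\<close> to \<open>d * j + d - 1\<close>.  This is the tensor product of \<open>u\<close> with the
  indicator vector of \<open>S\<close>.\<close>

definition tile :: "nat \<Rightarrow> nat \<Rightarrow> nat set \<Rightarrow> bit vec \<Rightarrow> bit vec" where
  "tile n d S u = vec n (\<lambda>i. if i div d \<in> S then u $ (i mod d) else 0)"

definition tiles :: "nat \<Rightarrow> nat \<Rightarrow> nat set \<Rightarrow> bit vec set" where
  "tiles n d S = tile n d S ` cube d"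

lemma card_cube_ge: "2 ^ d \<le> card (cube d)"
proof -
  let ?f = "\<lambda>U. vec d (\<lambda>i. if i \<in> U then 1 else 0 :: bit)"
  have "inj_on ?f (Pow {..<d})"
  proof (rule inj_onI)
    fix U U' assume U: "U \<in> Pow {..<d}" "U' \<in> Pow {..<d}" and eq: "?f U = ?f U'"
    have "i \<in> U \<longleftrightarrow> i \<in> U'" if "i < d" for i
      using arg_cong[OF eq, of "\<lambda>v. v $ i"] that by (simp split: if_splits)
    then show "U = U'" using U by blast
  qed
  then have "card (Pow {..<d}) \<le> card (cube d)"
    by (rule card_inj_on_le) (auto simp: finite_cube)
  then show ?thesis by (simp add: card_Pow)
qed

lemma tiles_subset: "tiles n d S \<subseteq> cube n"
  by (auto simp: tiles_def tile_def)

lemma tile_add: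
  assumes "d > 0" "u \<in> cube d" "v \<in> cube d"
  shows "tile n d S (u + v) = tile n d S u + tile n d S v"
  using assms by (intro eq_vecI) (auto simp: tile_def)

lemma tiles_add: "d > 0 \<Longrightarrow> x \<in> tiles n d S \<Longrightarrow> y \<in> tiles n d S \<Longrightarrow> x + y \<in> tiles n d S"
  unfolding tiles_def by (auto simp flip: tile_add)

lemma tile_nth:
  assumes "r < d" "j < n div d"
  shows "tile n d S u $ (d * j + r) = (if j \<in> S then u $ r else 0)"
proof -
  have "d * j + r < d * Suc j" using assms by simp
  also have "\<dots> \<le> d * (n div d)" using assms by (intro mult_left_mono) auto
  also have "\<dots> \<le> n" by simp
  finally have "d * j + r < n" .
  then show ?thesis using assms by (simp add: tile_def)
qed

lemma card_tiles:
  assumes "S \<subseteq> {..<n div d}" "S \<noteq> {}"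
  shows "card (tiles n d S) = card (cube d)"
proof -
  obtain j where j: "j \<in> S" "j < n div d" using assms by auto
  have "inj_on (tile n d S) (cube d)"
  proof (rule inj_onI)
    fix u v assume uv: "u \<in> cube d" "v \<in> cube d" and eq: "tile n d S u = tile n d S v"
    have "u $ r = v $ r" if "r < d" for r
      using arg_cong[OF eq, of "\<lambda>x. x $ (d * j + r)"] j that by (simp add: tile_nth)
    then show "u = v" using uv by (intro eq_vecI) auto
  qed
  then show ?thesis by (simp add: tiles_def card_image)
qed

text \<open>If the word \<open>u\<close> of \<open>x\<close> has a nonzero letter at position \<open>r\<close>, then coordinate \<open>r\<close> of each
  block in \<open>S\<close> is nonzero in \<open>x\<close>, which forces the block into \<open>S'\<close>.  The reverse inclusion follows by
  exchanging the roles of \<open>S\<close> and \<open>S'\<close>.\<close>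

lemma tiles_determine_blocks:
  assumes S: "S \<subseteq> {..<n div d}" and x: "x \<in> tiles n d S" "x \<in> tiles n d S'" "x \<noteq> 0\<^sub>v n"
  shows "S \<subseteq> S'"
proof
  fix j assume j: "j \<in> S"
  obtain u where u: "u \<in> cube d" "x = tile n d S u" using x by (auto simp: tiles_def)
  obtain v where v: "x = tile n d S' v" using x by (auto simp: tiles_def)
  have "d > 0" using j S by (cases d) auto
  have "\<exists>r<d. u $ r \<noteq> 0"
  proof (rule ccontr)
    assume "\<not> ?thesis"
    then have "x = 0\<^sub>v n" using \<open>d > 0\<close> unfolding u by (intro eq_vecI) (auto simp: tile_def)
    then show False using x by simp
  qed
  then obtain r where r: "r < d" "u $ r \<noteq> 0" by blast
  have "tile n d S u $ (d * j + r) = tile n d S' v $ (d * j + r)" using u v by simp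
  then show "j \<in> S'" using r j S by (auto simp: tile_nth subset_iff split: if_splits)
qed

lemma
  assumes "linear_subspace n H"
  shows linear_subspace_subset: "H \<subseteq> cube n"
    and linear_subspace_add: "x \<in> H \<Longrightarrow> y \<in> H \<Longrightarrow> x + y \<in> H"
proof -
  interpret H: subspace class_ring H "module_vec TYPE(bit) n"
    using assms by (simp add: linear_subspace_def)
  show "H \<subseteq> cube n"
    using H.submod by (simp add: submodule_def module_vec_simps)
  show "x \<in> H \<Longrightarrow> y \<in> H \<Longrightarrow> x + y \<in> H"
    using H.submod by (simp add: submodule_def module_vec_simps)
qed

text \<open>Two distinct elements of \<open>A\<close> share a coset, and their difference, which equals their sum over
  \<open>F\<^sub>2\<close>, lies in both \<open>A\<close> and \<open>H\<close>.\<close>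

lemma cover_meets_nontrivially:
  assumes H: "linear_subspace n H" and cov: "covered_by_cosets n H r A"
    and A: "A \<subseteq> cube n" and r: "r < card A"
    and closed: "\<And>x y. x \<in> A \<Longrightarrow> y \<in> A \<Longrightarrow> x + y \<in> A"
  shows "\<exists>x\<in>A \<inter> H. x \<noteq> 0\<^sub>v n"
proof -
  obtain \<S> where \<S>: "\<S> \<subseteq> cosets n H" "finite \<S>" "card \<S> \<le> r" "A \<subseteq> \<Union>\<S>"
    using cov by (auto simp: covered_by_cosets_def)
  have "\<forall>x\<in>A. \<exists>E\<in>\<S>. x \<in> E" using \<S> by blast
  then obtain f where f: "\<And>x. x \<in> A \<Longrightarrow> f x \<in> \<S> \<and> x \<in> f x" by metis
  have "\<not> inj_on f A"
  proof
    assume "inj_on f A"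
    then have "card A \<le> card \<S>" using f \<S> by (intro card_inj_on_le[of f]) auto
    then show False using \<S> r by linarith
  qed
  then obtain x y where xy: "x \<in> A" "y \<in> A" "f x = f y" "x \<noteq> y" by (auto simp: inj_on_def)
  then have "f x \<in> cosets n H" "x \<in> f x" "y \<in> f x" using f \<S> by (auto; metis)+
  then obtain c h h' where c: "c \<in> cube n" "h \<in> H" "h' \<in> H" "x = c + h" "y = c + h'"
    by (auto simp: cosets_def elt_set_plus_def)
  have bb: "(b::bit) + b = 0" for b by (cases b) auto
  have dims: "x \<in> cube n" "y \<in> cube n" "h \<in> cube n" "h' \<in> cube n"
    using xy A c linear_subspace_subset[OF H] by auto
  have "x + y = h + h'"
  proof (rule eq_vecI)
    show "(x + y) $ i = (h + h') $ i" if "i < dim_vec (h + h')" for i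
      using that dims c bb[of "c $ i"] by (auto simp: algebra_simps simp flip: add.assoc)
  qed (use dims in auto)
  then have "x + y \<in> A \<inter> H" using linear_subspace_add[OF H c(2,3)] closed[OF xy(1,2)] by simp
  moreover have "x + y \<noteq> 0\<^sub>v n"
  proof
    assume eq: "x + y = 0\<^sub>v n"
    have "x $ i = y $ i" if "i < n" for i
      using arg_cong[OF eq, of "\<lambda>v. v $ i"] that dims by (cases "x $ i"; cases "y $ i") auto
    then show False using xy dims by (auto intro: eq_vecI)
  qed
  ultimately show ?thesis by blast
qed

text \<open>Each \<open>S\<close> counted here owns a nonzero element of \<open>H\<close>, and no two of them share one, so their number
  is at most \<open>|H|\<close>.\<close>

lemma card_good_tiles_le:
  fixes r :: real
  assumes d: "d > 0" and r: "r < card (cube d)"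
  shows "card {S \<in> Pow {..<n div d} - {{}}. linear_subspace n H \<and> card H \<le> card (tiles n d S) \<and>
      covered_by_cosets n H r (tiles n d S)} \<le> card (cube d)" (is "card ?G \<le> _")
proof (cases "?G = {}")
  case True
  then show ?thesis by (simp only: card.empty)
next
  case False
  then obtain S where S: "S \<in> ?G" by blast
  then have H: "linear_subspace n H" and cH: "card H \<le> card (cube d)"
    using card_tiles[of S n d] by auto
  have "finite H"
    using linear_subspace_subset[OF H] finite_cube by (rule finite_subset)
  have "\<exists>x. x \<in> tiles n d S \<and> x \<in> H \<and> x \<noteq> 0\<^sub>v n" if "S \<in> ?G" for S
    using that cover_meets_nontrivially[OF H, of r "tiles n d S"] r
    by (auto simp: tiles_subset card_tiles tiles_add[OF d])
  then have "\<forall>S\<in>?G. \<exists>x. x \<in> tiles n d S \<and> x \<in> H \<and> x \<noteq> 0\<^sub>v n"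
    by blast
  from bchoice[OF this] obtain g
    where g: "\<And>S. S \<in> ?G \<Longrightarrow> g S \<in> tiles n d S \<and> g S \<in> H \<and> g S \<noteq> 0\<^sub>v n"
    by blast
  have "inj_on g ?G"
  proof (rule inj_onI)
    fix S S' assume S: "S \<in> ?G" "S' \<in> ?G" and eq: "g S = g S'"
    show "S = S'"
    proof (rule subset_antisym)
      show "S \<subseteq> S'"
        by (rule tiles_determine_blocks[of S n d "g S"]) (use S g[OF S(1)] g[OF S(2)] eq in auto)
      show "S' \<subseteq> S"
        by (rule tiles_determine_blocks[of S' n d "g S'"]) (use S g[OF S(1)] g[OF S(2)] eq in auto)
    qed
  qed
  then have "card ?G \<le> card H"
    using g \<open>finite H\<close> by (intro card_inj_on_le[of g]) auto
  then show ?thesis using cH by simp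
qed

lemma exponential_beats_polynomial:
  fixes a D :: real and d :: nat
  assumes "d > 0"
  shows "\<exists>N. \<forall>n\<ge>N. D + 8 * (real n)\<^sup>2 < (2 ^ (n div d) - 1) * real n powr (- a)"
proof -
  define e where "e = 1 / real d"
  have e: "e > 0" using assms by (simp add: e_def)
  have "eventually (\<lambda>n. D + 8 * (real n)\<^sup>2 < (2 powr (e * real n - 1) - 1) * real n powr (- a)) at_top"
    using e by real_asymp
  then obtain N where N: "\<And>n. n \<ge> N \<Longrightarrow>
      D + 8 * (real n)\<^sup>2 < (2 powr (e * real n - 1) - 1) * real n powr (- a)"
    unfolding eventually_sequentially by blast
  have "2 powr (e * real n - 1) \<le> 2 ^ (n div d)" for n
  proof -
    have "real n < real d * (real (n div d) + 1)"
      using assms dividend_less_times_div[of d n]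
      by (metis of_nat_1 of_nat_add of_nat_less_iff of_nat_mult add.commute
          mult_Suc_right plus_1_eq_Suc)
    then have "e * real n - 1 \<le> real (n div d)"
      using assms by (simp add: e_def field_simps)
    then have "2 powr (e * real n - 1) \<le> 2 powr real (n div d)" by simp
    then show ?thesis by (simp add: powr_realpow)
  qed
  then have "(2 powr (e * real n - 1) - 1) * real n powr (- a)
      \<le> (2 ^ (n div d) - 1) * real n powr (- a)" for n
    by (intro mult_right_mono) auto
  then show ?thesis using N order_less_le_trans by blast
qed

theorem theorem5p2:
  fixes K :: real
  assumes "K \<ge> 1"
  shows "\<exists>c::real. c > 0 \<and> (\<forall>C::real. \<forall>a::real. C > 0 \<longrightarrow> a > 0 \<longrightarrow>
    (\<exists>N::nat. \<forall>(Q :: nat \<Rightarrow> query_algorithm) (t :: nat \<Rightarrow> nat) (n0 :: nat).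
      (\<forall>n. is_query_algorithm n (Q n) \<and> num_queries (Q n) \<le> t n) \<longrightarrow>
      (\<forall>n\<ge>n0. \<forall>A. A \<subseteq> cube n \<longrightarrow> A \<noteq> {} \<longrightarrow> real (card (A + A)) \<le> K * real (card A) \<longrightarrow>
         output_prob n (Q n) A
           (\<lambda>H. linear_subspace n H \<and> card H \<le> card A \<and>
                covered_by_cosets n H ((2 * K) powr C) A)
         \<ge> real n powr (- a)) \<longrightarrow>
      (\<forall>n\<ge>max N n0. real (t n) \<ge> c * real n)))"
proof (rule exI[of _ 1], intro conjI allI impI)
  fix C a :: real
  define r where "r = (2 * K) powr C"
  obtain d0 where "r < 2 ^ d0" using real_arch_pow[of 2 r] by auto
  \<comment> \<open>The step to \<open>Suc d0\<close> makes the block length positive.\<close>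
  also have "(2::real) ^ d0 \<le> 2 ^ Suc d0" by simp
  also have "\<dots> \<le> card (cube (Suc d0))"
    using card_cube_ge[of "Suc d0"] by (metis of_nat_le_iff of_nat_numeral of_nat_power)
  finally obtain d where d: "d > 0" "r < card (cube d)" by blast
  obtain N where N: "\<And>n. n \<ge> N \<Longrightarrow>
      2 * real (card (cube d)) + 8 * (real n)\<^sup>2 < (2 ^ (n div d) - 1) * real n powr (- a)"
    using exponential_beats_polynomial[OF d(1)] by blast
  show "\<exists>N::nat. \<forall>(Q :: nat \<Rightarrow> query_algorithm) (t :: nat \<Rightarrow> nat) (n0 :: nat).
      (\<forall>n. is_query_algorithm n (Q n) \<and> num_queries (Q n) \<le> t n) \<longrightarrow>
      (\<forall>n\<ge>n0. \<forall>A. A \<subseteq> cube n \<longrightarrow> A \<noteq> {} \<longrightarrow> real (card (A + A)) \<le> K * real (card A) \<longrightarrow>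
         output_prob n (Q n) A
           (\<lambda>H. linear_subspace n H \<and> card H \<le> card A \<and>
                covered_by_cosets n H ((2 * K) powr C) A)
         \<ge> real n powr (- a)) \<longrightarrow>
      (\<forall>n\<ge>max N n0. real (t n) \<ge> 1 * real n)"
    unfolding r_def[symmetric]
  proof (intro exI[of _ N] allI impI)
    fix Q :: "nat \<Rightarrow> query_algorithm" and t :: "nat \<Rightarrow> nat" and n0 n :: nat
    let ?P = "\<lambda>A H. linear_subspace n H \<and> card H \<le> card A \<and> covered_by_cosets n H r A"
    assume alg: "\<forall>n. is_query_algorithm n (Q n) \<and> num_queries (Q n) \<le> t n"
      and succ: "\<forall>n\<ge>n0. \<forall>A. A \<subseteq> cube n \<longrightarrow> A \<noteq> {} \<longrightarrow> real (card (A + A)) \<le> K * real (card A) \<longrightarrow>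
         output_prob n (Q n) A
           (\<lambda>H. linear_subspace n H \<and> card H \<le> card A \<and> covered_by_cosets n H r A)
         \<ge> real n powr (- a)"
      and n: "max N n0 \<le> n"
    define I where "I = Pow {..<n div d} - {{}}"
    define V where "V = tiles n d"
    have finI: "finite I" by (simp add: I_def)
    have cI: "real (card I) = 2 ^ (n div d) - 1"
      by (simp add: I_def card_Diff_singleton card_Pow of_nat_diff)
    have zero: "0\<^sub>v n \<in> V S" for S
      unfolding V_def tiles_def
      by (rule image_eqI[of _ _ "0\<^sub>v d"]) (use d in \<open>auto simp: tile_def intro!: eq_vecI\<close>)
    \<comment> \<open>A set closed under addition has doubling constant at most \<open>1 \<le> K\<close>.\<close>
    have "real n powr (- a) \<le> output_prob n (Q n) (V S) (?P (V S))" if "S \<in> I" for S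
    proof -
      have "V S + V S \<subseteq> V S" using tiles_add[OF d(1)] by (auto simp: V_def set_plus_def)
      moreover have "finite (V S)" by (simp add: V_def tiles_def finite_cube)
      ultimately have "real (card (V S + V S)) \<le> 1 * real (card (V S))"
        by (simp add: card_mono)
      also have "\<dots> \<le> K * real (card (V S))" using assms by (intro mult_right_mono) auto
      finally show ?thesis
        using succ n zero[of S] tiles_subset[of n d S] by (auto simp: V_def)
    qed
    then have "card I * real n powr (- a) \<le> (\<Sum>S\<in>I. output_prob n (Q n) (V S) (?P (V S)))"
      by (intro sum_bounded_below) auto
    also have "\<dots> \<le> 2 * real (card (cube d)) + 8 * (real (num_queries (Q n)))\<^sup>2"
    proof (rule sum_output_prob_le[OF _ finI, where A' = "{0\<^sub>v n}"])
      show "is_query_algorithm n (Q n)" using alg by simp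
      have "S = S'" if "S \<in> I" "S' \<in> I" "x \<in> V S" "x \<in> V S'" "x \<noteq> 0\<^sub>v n" for S S' x
        using tiles_determine_blocks[of S n d x S'] tiles_determine_blocks[of S' n d x S] that
        by (auto simp: V_def I_def)
      then show "disjoint_family_on (\<lambda>S. sym_diff (V S) {0\<^sub>v n}) I"
        using zero by (fastforce simp: disjoint_family_on_def)
      show "card {S \<in> I. ?P (V S) H} \<le> card (cube d)" for H
        using card_good_tiles_le[OF d, of n H] by (simp add: I_def V_def)
    qed
    finally have "8 * (real n)\<^sup>2 < 8 * (real (num_queries (Q n)))\<^sup>2"
      using N[of n] n cI by simp
    then have "(real n)\<^sup>2 < (real (num_queries (Q n)))\<^sup>2"
      by simp
    then have "real n < real (num_queries (Q n))"
      by (rule power2_less_imp_less) simp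
    then show "1 * real n \<le> real (t n)" using alg
      by (metis mult_1 less_imp_le of_nat_le_iff order_trans)
  qed
qed simp

end
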